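(* Consider the equation with distributed delays $$\dot{x}(t)+f(t,x(t))+\sum_{k=1}^m\int_{h_k(t)}^t g_k(t,x(s))\,d_sR_k(t,s)=0,\quad t\geq 0,$$ with the initial condition $x(t)=\varphi(t)$, $t\leq 0$, where: (i) $h_1,\dots,h_m:[0,\infty)\to\mathbb{R}$ are Lebesgue measurable, $h_k(t)\leq t$ and $\lim_{t\to\infty}h_k(t)=\infty$; $\varphi:(-\infty,0]\to\mathbb{R}$ is continuous and bounded; (ii) for $k=1,\dots,m$, $R_k(t,s)$ is nondecreasing in $s$ for almost all $t$ and $\int_{h_k(t)}^t d_sR_k(t,s)\equiv 1$; (iii) $f(t,u)$ and $g_k(t,u)$ are continuous, $f(t,0)=g_k(t,0)=0$, and $f(t,u)u>0$, $g_k(t,u)u>0$ for any $u\neq 0$ and $k=1,\dots,m$; (iv) there are $x_1^0,x_2^0,x_1,x_2$ with $-\infty\leq x_1^0\leq 0\leq x_2^0\leq\infty$ and $-\infty<x_1\leq 0\leq x_2<\infty$ such that for any $\varphi$ with $x_1^0\leq\varphi\leq x_2^0$ there exists a unique global solution $x$ of the initial value problem, and it satisfies $x_1\leq x(t)\leq x_2$. Assume that there are positive numbers $a_0,A,b_k$, $k=1,\dots,m$, such that for any $u$ with $x_1\leq u\leq x_2$, $u\neq 0$ (and all $t\ge 0$), $$a_0\leq\frac{f(t,u)}{u}\leq A,\qquad 0\leq\frac{g_k(t,u)}{u}\leq b_k,\quad k=1,\dots,m.$$ Assume also that $t-h_k(t)\leq h_0$ for some constant $h_0$ and all $k$, that $b_0=\sum_{k=1}^m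 b_k$, and that $$\frac{a_0}{b_0}e^{-Ah_0}>\ln\frac{b_0^2+a_0b_0}{b_0^2+a_0^2}.$$ Then the zero solution is an attractor of all solutions of the initial value problem with initial function satisfying $x_1^0\leq\varphi\leq x_2^0$, i.e. every such solution satisfies $\lim_{t\to\infty}x(t)=0$.
   Context: The integrals with respect to $d_sR_k(t,s)$ are Stieltjes integrals in the variable $s$, for fixed $t$. A solution of the initial value problem is a function $x$ that is absolutely continuous on $[0,\infty)$ (i.e. on its bounded subintervals), satisfies the differential equation for almost every $t\geq 0$, and satisfies $x(t)=\varphi(t)$ for $t\leq 0$. Inequalities $x_1^0\leq\varphi\leq x_2^0$ are understood pointwise on $(-\infty,0]$. *)

theory Defs
  imports "HOL-Analysis.Analysis"
begin

(* Riemann-Stieltjes integral of u with respect to r over the closed interval [a,b], as the limit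
   of the Riemann-Stieltjes sums when the mesh tends to 0. The integrator is not assumed continuous
   from either side, and its jumps at the endpoints count:
   in particular the constant 1 has integral r b - r a. *)
definition has_stieltjes_integral ::
    "(real \<Rightarrow> real) \<Rightarrow> (real \<Rightarrow> real) \<Rightarrow> real \<Rightarrow> real \<Rightarrow> real \<Rightarrow> bool" where
  "has_stieltjes_integral u r a b I \<longleftrightarrow>
     (\<forall>\<epsilon>>0. \<exists>\<delta>>0. \<forall>p. p tagged_division_of {a..b} \<and> (\<lambda>s. ball s \<delta>) fine p \<longrightarrow>
        \<bar>(\<Sum>(s, K)\<in>p. u s * (r (Sup K) - r (Inf K))) - I\<bar> < \<epsilon>)"

(* A finite family of nonoverlapping compact subintervals of [a,b] is a division of its own union;
   for K = [c,d] one has Inf K = c and Sup K = d. *)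
definition abs_continuous_on_interval :: "(real \<Rightarrow> real) \<Rightarrow> real \<Rightarrow> real \<Rightarrow> bool" where
  "abs_continuous_on_interval x a b \<longleftrightarrow>
     (\<forall>\<epsilon>>0. \<exists>\<delta>>0. \<forall>D. D division_of \<Union>D \<and> \<Union>D \<subseteq> {a..b} \<and> (\<Sum>K\<in>D. Sup K - Inf K) < \<delta> \<longrightarrow>
        (\<Sum>K\<in>D. \<bar>x (Sup K) - x (Inf K)\<bar>) < \<epsilon>)"

definition initial_function :: "ereal \<Rightarrow> ereal \<Rightarrow> (real \<Rightarrow> real) \<Rightarrow> bool" where
  "initial_function l u \<phi> \<longleftrightarrow> continuous_on {..0} \<phi> \<and> bounded (\<phi> ` {..0}) \<and>
     (\<forall>t\<le>0. l \<le> ereal (\<phi> t) \<and> ereal (\<phi> t) \<le> u)"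

(* The values of \<phi> on (0,\<infinity>), of f, g k, h k, R k at negative times, and of g k, h k, R k for k
   outside {1..m}, are irrelevant. *)
definition solution ::
    "nat \<Rightarrow> (real \<Rightarrow> real \<Rightarrow> real) \<Rightarrow> (nat \<Rightarrow> real \<Rightarrow> real \<Rightarrow> real) \<Rightarrow> (nat \<Rightarrow> real \<Rightarrow> real) \<Rightarrow>
     (nat \<Rightarrow> real \<Rightarrow> real \<Rightarrow> real) \<Rightarrow> (real \<Rightarrow> real) \<Rightarrow> (real \<Rightarrow> real) \<Rightarrow> bool" where
  "solution m f g h R \<phi> x \<longleftrightarrow>
     (\<forall>T\<ge>0. abs_continuous_on_interval x 0 T) \<and>
     (AE t in lebesgue_on {0..}. \<exists>x' I.
        (x has_real_derivative x') (at t) \<and>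
        (\<forall>k\<in>{1..m}. has_stieltjes_integral (\<lambda>s. g k t (x s)) (R k t) (h k t) t (I k)) \<and>
        x' + f t (x t) + (\<Sum>k=1..m. I k) = 0) \<and>
     (\<forall>t\<le>0. x t = \<phi> t)"

end

theory Submission
  imports Defs
begin

text \<open>
  Along a solution the equation reads \<open>x' = - a(t) x - I(t)\<close> with \<open>a0 \<le> a(t) \<le> A\<close>, and \<open>I(t)\<close> lies
  between \<open>b0 * inf (min x 0)\<close> and \<open>b0 * sup (max x 0)\<close> over the memory window \<open>[t - h0, t]\<close>. If \<open>x\<close> is eventually of one sign, then \<open>I\<close>
  only helps and \<open>x\<close> decays like \<open>exp (- a0 t)\<close>. Otherwise suppose \<open>x \<ge> - m\<close> and let \<open>t1\<close> be the last
  zero before a time at which \<open>x > 0\<close>. With \<open>\<beta> = b0 / a0\<close>, integrating backwards from \<open>t1\<close> gives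
  \<open>- x(s) \<le> min m (\<beta> m (exp (A (t1 - s)) - 1))\<close>, and integrating forwards with this bound on the memory
  gives \<open>x \<le> \<kappa> m\<close> where \<open>\<kappa> = \<beta> (\<beta> + 1) exp (- exp (- A h0) / \<beta>) - \<beta>^2\<close>. The hypothesis on the
  logarithm says exactly that \<open>\<kappa> < 1\<close>, so the amplitude contracts. This value of \<open>\<kappa>\<close> needs
  \<open>A h0 \<ge> ln (1 + 1 / \<beta>)\<close>; if that fails, \<open>h0\<close> is replaced by the larger delay with equality, for
  which the hypothesis holds automatically.
\<close>

subsection \<open>Absolute continuity and differential inequalities\<close>

text \<open>Split at \<open>t\<close>: each half of the increment differs from \<open>d\<close>
  times its length by at most \<open>e\<close> times its length, and \<open>d \<le> 0\<close> drops
  out. Both endpoints may move, as intervals tagged by \<open>t\<close> require.\<close>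

lemma derivative_straddle:
  fixes z :: "real \<Rightarrow> real"
  assumes "(z has_real_derivative d) (at t)" "d \<le> 0" "e > 0"
  shows "\<exists>r>0. \<forall>u v. u \<le> t \<longrightarrow> t \<le> v \<longrightarrow> u \<in> ball t r \<longrightarrow> v \<in> ball t r \<longrightarrow> z v - z u \<le> e * (v - u)"
proof -
  have "(z has_derivative (*) d) (at t)"
    using assms(1) by (simp add: has_field_derivative_def)
  then obtain r where r: "r > 0"
    "\<And>y. norm (y - t) < r \<Longrightarrow> norm (z y - z t - d * (y - t)) \<le> e * norm (y - t)"
    unfolding has_derivative_at_alt using assms(3) by blast
  have "z v - z u \<le> e * (v - u)"
    if uv: "u \<le> t" "t \<le> v" "u \<in> ball t r" "v \<in> ball t r" for u v
  proof -
    have "\<bar>z v - z t - d * (v - t)\<bar> \<le> e * (v - t)" "\<bar>z u - z t - d * (u - t)\<bar> \<le> e * (t - u)"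
      using r(2)[of v] r(2)[of u] uv by (auto simp: dist_real_def)
    then have "z v - z t \<le> d * (v - t) + e * (v - t)" "z t - z u \<le> - (d * (u - t)) + e * (t - u)"
      by linarith+
    moreover have "d * (v - t) \<le> 0" "- (d * (u - t)) \<le> 0"
      using assms(2) uv by (auto simp: mult_nonpos_nonneg mult_nonpos_nonpos)
    ultimately have "z v - z u \<le> e * (v - t) + e * (t - u)" by linarith
    then show ?thesis by (simp add: algebra_simps)
  qed
  then show ?thesis using r(1) by blast
qed

lemma abs_continuousE:
  assumes "abs_continuous_on_interval x a b" "e > 0"
  obtains \<delta> where "\<delta> > 0" "\<And>D. D division_of \<Union>D \<Longrightarrow> \<Union>D \<subseteq> {a..b} \<Longrightarrow>
      (\<Sum>K\<in>D. Sup K - Inf K) < \<delta> \<Longrightarrow> (\<Sum>K\<in>D. \<bar>x (Sup K) - x (Inf K)\<bar>) < e"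
proof -
  have "\<exists>\<delta>>0. \<forall>D. D division_of \<Union>D \<and> \<Union>D \<subseteq> {a..b} \<and> (\<Sum>K\<in>D. Sup K - Inf K) < \<delta> \<longrightarrow>
        (\<Sum>K\<in>D. \<bar>x (Sup K) - x (Inf K)\<bar>) < e"
    using assms(1)[unfolded abs_continuous_on_interval_def, rule_format, OF assms(2)] .
  then show ?thesis using that by auto
qed

section \<open>Elementary properties of absolutely continuous functions\<close>

lemma abs_continuous_mono:
  assumes "abs_continuous_on_interval x a b" "a \<le> c" "d \<le> b"
  shows "abs_continuous_on_interval x c d"
  unfolding abs_continuous_on_interval_def
proof (intro allI impI)
  fix e :: real assume "e > 0"
  obtain \<delta> where "\<delta> > 0" and \<delta>: "\<And>D. D division_of \<Union>D \<Longrightarrow> \<Union>D \<subseteq> {a..b} \<Longrightarrow>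
      (\<Sum>K\<in>D. Sup K - Inf K) < \<delta> \<Longrightarrow> (\<Sum>K\<in>D. \<bar>x (Sup K) - x (Inf K)\<bar>) < e"
    by (rule abs_continuousE[OF assms(1) \<open>e > 0\<close>]) blast
  have sub: "{c..d} \<subseteq> {a..b}" using assms by auto
  show "\<exists>\<delta>>0. \<forall>D. D division_of \<Union>D \<and> \<Union>D \<subseteq> {c..d} \<and> (\<Sum>K\<in>D. Sup K - Inf K) < \<delta> \<longrightarrow>
        (\<Sum>K\<in>D. \<bar>x (Sup K) - x (Inf K)\<bar>) < e"
    using \<open>\<delta> > 0\<close> \<delta> subset_trans[OF _ sub] by blast
qed

lemma abs_continuous_uminus:
  "abs_continuous_on_interval x a b \<Longrightarrow> abs_continuous_on_interval (\<lambda>t. - x t) a b"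
  by (simp add: abs_continuous_on_interval_def abs_minus_commute)

lemma abs_continuous_diff:
  assumes "abs_continuous_on_interval x a b" "abs_continuous_on_interval y a b"
  shows "abs_continuous_on_interval (\<lambda>t. x t - y t) a b"
  unfolding abs_continuous_on_interval_def
proof (intro allI impI)
  fix e :: real assume "e > 0"
  then have "e/2 > 0" by simp
  obtain \<delta>1 where \<delta>1: "\<delta>1 > 0" "\<And>D. D division_of \<Union>D \<Longrightarrow> \<Union>D \<subseteq> {a..b} \<Longrightarrow>
      (\<Sum>K\<in>D. Sup K - Inf K) < \<delta>1 \<Longrightarrow> (\<Sum>K\<in>D. \<bar>x (Sup K) - x (Inf K)\<bar>) < e/2"
    by (rule abs_continuousE[OF assms(1) \<open>e/2 > 0\<close>]) blast
  obtain \<delta>2 where \<delta>2: "\<delta>2 > 0" "\<And>D. D division_of \<Union>D \<Longrightarrow> \<Union>D \<subseteq> {a..b} \<Longrightarrow>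
      (\<Sum>K\<in>D. Sup K - Inf K) < \<delta>2 \<Longrightarrow> (\<Sum>K\<in>D. \<bar>y (Sup K) - y (Inf K)\<bar>) < e/2"
    by (rule abs_continuousE[OF assms(2) \<open>e/2 > 0\<close>]) blast
  show "\<exists>\<delta>>0. \<forall>D. D division_of \<Union>D \<and> \<Union>D \<subseteq> {a..b} \<and> (\<Sum>K\<in>D. Sup K - Inf K) < \<delta> \<longrightarrow>
        (\<Sum>K\<in>D. \<bar>x (Sup K) - y (Sup K) - (x (Inf K) - y (Inf K))\<bar>) < e"
  proof (intro exI[of _ "min \<delta>1 \<delta>2"] conjI allI impI)
    fix D assume D: "D division_of \<Union>D \<and> \<Union>D \<subseteq> {a..b} \<and> (\<Sum>K\<in>D. Sup K - Inf K) < min \<delta>1 \<delta>2"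
    have "(\<Sum>K\<in>D. \<bar>x (Sup K) - y (Sup K) - (x (Inf K) - y (Inf K))\<bar>)
        \<le> (\<Sum>K\<in>D. \<bar>x (Sup K) - x (Inf K)\<bar> + \<bar>y (Sup K) - y (Inf K)\<bar>)"
      by (intro sum_mono) linarith
    also have "\<dots> < e/2 + e/2"
      using \<delta>1(2)[of D] \<delta>2(2)[of D] D by (simp add: sum.distrib)
    finally show "(\<Sum>K\<in>D. \<bar>x (Sup K) - y (Sup K) - (x (Inf K) - y (Inf K))\<bar>) < e" by simp
  qed (use \<delta>1 \<delta>2 in auto)
qed

lemma division_real_interval:
  fixes D :: "real set set"
  assumes "D division_of S" "K \<in> D"
  shows "Inf K \<le> Sup K" "K = {Inf K..Sup K}" "Inf K \<in> K" "Sup K \<in> K"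
proof -
  obtain c d where "K = cbox c d" "K \<noteq> {}" using division_ofD[OF assms(1)] assms(2) by metis
  then have "K = {c..d}" "c \<le> d" by auto
  then show "Inf K \<le> Sup K" "K = {Inf K..Sup K}" "Inf K \<in> K" "Sup K \<in> K" by auto
qed

text \<open>A bound \<open>L\<close> for the derivative on the compact interval makes
  \<open>y\<close> Lipschitz, so \<open>\<delta> = e / L\<close> works. This serves all the explicit
  comparison functions below.\<close>

lemma C1_abs_continuous:
  fixes y :: "real \<Rightarrow> real"
  assumes der: "\<And>t. (y has_real_derivative y' t) (at t)" and cont: "continuous_on {a..b} y'"
  shows "abs_continuous_on_interval y a b"
proof -
  have "bounded (y' ` {a..b})"
    using compact_continuous_image[OF cont] compact_imp_bounded by auto
  then obtain L where L: "L > 0" "\<And>t. t \<in> {a..b} \<Longrightarrow> \<bar>y' t\<bar> \<le> L"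
    unfolding bounded_pos by (metis imageI real_norm_def)
  have lip: "\<bar>y d - y c\<bar> \<le> L * (d - c)" if "a \<le> c" "c \<le> d" "d \<le> b" for c d
  proof -
    have "norm (y d - y c) \<le> L * norm (d - c)"
      by (rule field_differentiable_bound[of "{a..b}" y y'])
         (use that der L in \<open>auto intro: has_field_derivative_at_within\<close>)
    then show ?thesis using that by simp
  qed
  show ?thesis
    unfolding abs_continuous_on_interval_def
  proof (intro allI impI)
    fix e :: real assume "e > 0"
    have "(\<Sum>K\<in>D. \<bar>y (Sup K) - y (Inf K)\<bar>) < e"
      if D: "D division_of \<Union>D" "\<Union>D \<subseteq> {a..b}" "(\<Sum>K\<in>D. Sup K - Inf K) < e / L" for D
    proof -
      have "(\<Sum>K\<in>D. \<bar>y (Sup K) - y (Inf K)\<bar>) \<le> (\<Sum>K\<in>D. L * (Sup K - Inf K))"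
      proof (intro sum_mono lip)
        fix K assume K: "K \<in> D"
        then have "K \<subseteq> {a..b}" using D by auto
        then show "a \<le> Inf K" "Sup K \<le> b" "Inf K \<le> Sup K"
          using division_real_interval[OF D(1) K] by auto
      qed
      also have "\<dots> < e" unfolding sum_distrib_left[symmetric] using D(3) L(1) by (simp only: pos_less_divide_eq mult.commute)
      finally show ?thesis .
    qed
    then show "\<exists>\<delta>>0. \<forall>D. D division_of \<Union>D \<and> \<Union>D \<subseteq> {a..b} \<and> (\<Sum>K\<in>D. Sup K - Inf K) < \<delta> \<longrightarrow>
        (\<Sum>K\<in>D. \<bar>y (Sup K) - y (Inf K)\<bar>) < e"
      using \<open>e > 0\<close> L(1) by (intro exI[of _ "e / L"]) auto
  qed
qed

lemma abs_continuous_imp_continuous: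
  assumes ac: "abs_continuous_on_interval x a b"
  shows "continuous_on {a..b} x"
  unfolding continuous_on_iff
proof (intro ballI allI impI)
  fix t e :: real assume t: "t \<in> {a..b}" and "e > 0"
  obtain \<delta> where "\<delta> > 0" and \<delta>: "\<And>D. D division_of \<Union>D \<Longrightarrow> \<Union>D \<subseteq> {a..b} \<Longrightarrow>
      (\<Sum>K\<in>D. Sup K - Inf K) < \<delta> \<Longrightarrow> (\<Sum>K\<in>D. \<bar>x (Sup K) - x (Inf K)\<bar>) < e"
    by (rule abs_continuousE[OF ac \<open>e > 0\<close>]) blast
  have main: "\<bar>x d - x c\<bar> < e" if "a \<le> c" "c \<le> d" "d \<le> b" "d - c < \<delta>" for c d
  proof -
    have "{cbox c d} division_of cbox c d" using that by (intro division_of_self) auto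
    then show ?thesis using \<delta>[of "{{c..d}}"] that by simp
  qed
  have "dist (x s) (x t) < e" if "s \<in> {a..b}" "dist s t < \<delta>" for s
    using main[of s t] main[of t s] t that by (cases "s \<le> t") (auto simp: dist_real_def)
  then show "\<exists>d>0. \<forall>s\<in>{a..b}. dist s t < d \<longrightarrow> dist (x s) (x t) < e" using \<open>\<delta> > 0\<close> by blast
qed

section \<open>Monotonicity and comparison from derivatives outside a null set\<close>

lemma negligible_outer_open:
  fixes N :: "real set"
  assumes "negligible N" "e > 0"
  obtains U where "open U" "N \<subseteq> U" "U \<in> lmeasurable" "measure lebesgue U < e"
proof -
  have N: "N \<in> lmeasurable" "measure lebesgue N = 0"
    using assms(1) by (simp_all add: negligible_iff_measure)
  obtain U where U: "open U" "N \<subseteq> U" "U - N \<in> lmeasurable" "emeasure lebesgue (U - N) < ennreal e"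
    using sets_lebesgue_outer_open[of N e] N(1) assms(2) by (metis fmeasurableD)
  have "U = (U - N) \<union> N" using U(2) by auto
  then have UL: "U \<in> lmeasurable" using fmeasurable.Un[OF U(3) N(1)] by simp
  have "measure lebesgue (U - N) < e"
    using U(3,4) assms(2) by (simp add: emeasure_eq_measure2 ennreal_less_iff)
  moreover have "measure lebesgue U \<le> measure lebesgue (U - N) + measure lebesgue N"
    using measure_Un_le[of "U - N" lebesgue N] U(3) N(1) \<open>U = (U - N) \<union> N\<close> by (metis fmeasurableD)
  ultimately show ?thesis using that U UL N by simp
qed

text \<open>The gauge treats tags in two ways. Intervals tagged outside \<open>N\<close> obey the
  straddle estimate and contribute at most \<open>\<epsilon> * (b - a)\<close>; those tagged in
  \<open>N\<close> lie in an open set of measure below \<open>\<delta>\<close>, so absolute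
  continuity bounds their total increment by \<open>e/2\<close>.\<close>

lemma abs_continuous_nonincreasing:
  assumes ab: "a \<le> b" and ac: "abs_continuous_on_interval z a b" and N: "negligible N"
    and der: "\<And>t. t \<in> {a..b} \<Longrightarrow> t \<notin> N \<Longrightarrow> \<exists>d\<le>0. (z has_real_derivative d) (at t)"
  shows "z b \<le> z a"
proof (rule field_le_epsilon)
  fix e :: real assume "e > 0"
  obtain \<delta> where "\<delta> > 0" and \<delta>: "\<And>D. D division_of \<Union>D \<Longrightarrow> \<Union>D \<subseteq> {a..b} \<Longrightarrow>
      (\<Sum>K\<in>D. Sup K - Inf K) < \<delta> \<Longrightarrow> (\<Sum>K\<in>D. \<bar>z (Sup K) - z (Inf K)\<bar>) < e/2"
    by (rule abs_continuousE[OF ac half_gt_zero[OF \<open>e > 0\<close>]]) blast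
  obtain U where U: "open U" "N \<subseteq> U" "U \<in> lmeasurable" "measure lebesgue U < \<delta>"
    using negligible_outer_open[OF N \<open>\<delta> > 0\<close>] by metis
  \<comment> \<open>The summand \<open>1\<close> keeps the denominator positive when
    \<open>a = b\<close>.\<close>
  define \<epsilon> where "\<epsilon> = e / (2 * (b - a + 1))"
  have \<epsilon>: "\<epsilon> > 0" "\<epsilon> * (b - a) \<le> e / 2"
    using \<open>e > 0\<close> ab by (auto simp: \<epsilon>_def field_simps)
  have "\<forall>t. \<exists>r>0. t \<in> {a..b} - N \<longrightarrow> (\<forall>u v. u \<le> t \<longrightarrow> t \<le> v \<longrightarrow> u \<in> ball t r \<longrightarrow> v \<in> ball t r
      \<longrightarrow> z v - z u \<le> \<epsilon> * (v - u))"
    using derivative_straddle[OF _ _ \<epsilon>(1)] der by (metis DiffE zero_less_one)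
  then obtain r where r: "\<And>t. r t > 0" "\<And>t u v. t \<in> {a..b} - N \<Longrightarrow> u \<le> t \<Longrightarrow> t \<le> v \<Longrightarrow>
      u \<in> ball t (r t) \<Longrightarrow> v \<in> ball t (r t) \<Longrightarrow> z v - z u \<le> \<epsilon> * (v - u)"
    by metis
  define G where "G t = (if t \<in> N then U else ball t (r t))" for t
  have "gauge G" using U r(1) by (auto simp: gauge_def G_def)
  then obtain p where p: "p tagged_division_of {a..b}" "G fine p"
    using fine_division_exists_real by blast
  note pD = tagged_division_ofD[OF p(1)]
  have int: "K = {Inf K..Sup K}" "Inf K \<le> Sup K" "Inf K \<le> t" "t \<le> Sup K" "t \<in> {a..b}"
    "Inf K \<in> K" "Sup K \<in> K" if "(t, K) \<in> p" for t K
  proof -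
    have "\<exists>c d. K = cbox c d" using pD(4) that by blast
    then obtain c d where K: "K = {c..d}" by auto
    moreover have "t \<in> K" "K \<subseteq> {a..b}" using pD that by auto
    ultimately show "K = {Inf K..Sup K}" "Inf K \<le> Sup K" "Inf K \<le> t" "t \<le> Sup K" "t \<in> {a..b}"
      "Inf K \<in> K" "Sup K \<in> K" by auto
  qed
  define q where "q = {(t, K) \<in> p. t \<in> N}"
  have qp: "q \<subseteq> p" by (auto simp: q_def)
  have tq: "q tagged_partial_division_of {a..b}"
    using p(1) qp tagged_partial_division_subset tagged_division_of_def by blast
  \<comment> \<open>The reindexing rule asks for a function vanishing on every box with empty
    interior, the empty box included; hence the default \<open>0\<close>.\<close>
  define w where "w f K = (if K = {} then 0 else f (Sup K) - f (Inf K) :: real)" for f :: "real \<Rightarrow> real" and K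
  \<comment> \<open>Only degenerate intervals can carry two tags in \<open>q\<close>, and these
    contribute \<open>F 0 = 0\<close>, so dropping the tags does not change the sum.\<close>
  have reindex: "(\<Sum>(t, K)\<in>q. F (f (Sup K) - f (Inf K))) = (\<Sum>K\<in>snd ` q. F (f (Sup K) - f (Inf K)))"
    if "F 0 = 0" for f F :: "real \<Rightarrow> real"
  proof -
    have "(\<Sum>(t, K)\<in>q. F (w f K)) = (\<Sum>K\<in>snd ` q. F (w f K))"
      by (rule sum.over_tagged_division_lemma[OF tagged_partial_division_of_Union_self[OF tq]])
         (use that in \<open>auto simp: w_def\<close>)
    moreover have "K \<noteq> {}" if "(t, K) \<in> q" for t K using that int(6)[of t K] qp by auto
    moreover have "(\<Sum>(t, K)\<in>q. F (w f K)) = (\<Sum>(t, K)\<in>q. F (f (Sup K) - f (Inf K)))"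
      by (rule sum.cong) (use calculation(2) in \<open>auto simp: w_def\<close>)
    moreover have "(\<Sum>K\<in>snd ` q. F (w f K)) = (\<Sum>K\<in>snd ` q. F (f (Sup K) - f (Inf K)))"
      by (rule sum.cong) (use calculation(2) in \<open>auto simp: w_def\<close>)
    ultimately show ?thesis by simp
  qed
  have divq: "snd ` q division_of \<Union>(snd ` q)"
    by (rule partial_division_of_tagged_division[OF tq])
  have "\<Union>(snd ` q) \<subseteq> U"
    using p(2) qp by (fastforce simp: fine_def q_def G_def)
  have "(\<Sum>K\<in>snd ` q. Sup K - Inf K) = (\<Sum>K\<in>snd ` q. measure lebesgue K)"
  proof (rule sum.cong[OF refl])
    fix K assume "K \<in> snd ` q"
    then have "K = {Inf K..Sup K}" "Inf K \<le> Sup K" using division_real_interval[OF divq] by auto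
    moreover have "measure lebesgue {c..d} = d - c" if "c \<le> d" for c d :: real using that by simp
    ultimately show "Sup K - Inf K = measure lebesgue K" by metis
  qed
  also have "\<dots> = measure lebesgue (\<Union>(snd ` q))"
    by (rule content_division[OF divq])
  also have "\<dots> \<le> measure lebesgue U"
    using \<open>\<Union>(snd ` q) \<subseteq> U\<close> U(3) divq
    by (intro measure_mono_fmeasurable) (auto intro: fmeasurableD lmeasurable_division)
  finally have small: "(\<Sum>K\<in>snd ` q. Sup K - Inf K) < \<delta>" using U(4) by simp
  have "\<Union>(snd ` q) \<subseteq> {a..b}" using pD(3) qp by fastforce
  then have "(\<Sum>K\<in>snd ` q. \<bar>z (Sup K) - z (Inf K)\<bar>) < e/2" using \<delta>[OF divq _ small] by simp
  then have bad: "(\<Sum>(t, K)\<in>q. \<bar>z (Sup K) - z (Inf K)\<bar>) < e/2" using reindex[of abs z] by simp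
  have fin: "finite p" using pD(1) .
  have "z b - z a = (\<Sum>(t, K)\<in>p. z (Sup K) - z (Inf K))"
    using additive_tagged_division_1[OF ab p(1), of z] by simp
  also have "\<dots> = (\<Sum>(t, K)\<in>p - q. z (Sup K) - z (Inf K)) + (\<Sum>(t, K)\<in>q. z (Sup K) - z (Inf K))"
    using sum.subset_diff[OF qp fin] by blast
  also have "\<dots> \<le> (\<Sum>(t, K)\<in>p - q. \<epsilon> * (Sup K - Inf K)) + (\<Sum>(t, K)\<in>q. \<bar>z (Sup K) - z (Inf K)\<bar>)"
  proof (intro add_mono sum_mono)
    fix i assume i: "i \<in> p - q"
    obtain t K where tK: "i = (t, K)" by force
    then have "(t, K) \<in> p" "t \<notin> N" using i by (auto simp: q_def)
    moreover have "K \<subseteq> ball t (r t)" using fineD[OF p(2), of t K] calculation by (simp add: G_def)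
    ultimately have "z (Sup K) - z (Inf K) \<le> \<epsilon> * (Sup K - Inf K)"
      using int[of t K] by (intro r(2)[of t]) auto
    then show "(case i of (t, K) \<Rightarrow> z (Sup K) - z (Inf K)) \<le> (case i of (t, K) \<Rightarrow> \<epsilon> * (Sup K - Inf K))"
      using tK by simp
  qed auto
  also have "(\<Sum>(t, K)\<in>p - q. \<epsilon> * (Sup K - Inf K)) \<le> (\<Sum>(t, K)\<in>p. \<epsilon> * (Sup K - Inf K))"
    by (rule sum_mono2[OF fin]) (use int(2) \<epsilon>(1) in auto)
  also have "\<dots> = \<epsilon> * (\<Sum>(t, K)\<in>p. Sup K - Inf K)"
    by (simp add: sum_distrib_left split_beta)
  also have "\<dots> = \<epsilon> * (b - a)"
    using additive_tagged_division_1[OF ab p(1), of "\<lambda>x. x"] by simp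
  finally show "z b \<le> z a + e" using bad \<epsilon>(2) by linarith
qed

text \<open>\<open>S\<close> is closed, so \<open>Sup S\<close> is its largest point; the
  intermediate value theorem gives a zero in \<open>{Sup S..b}\<close>, which belongs to
  \<open>S\<close> and is therefore \<open>Sup S\<close> itself.\<close>

lemma last_zero:
  fixes z :: "real \<Rightarrow> real"
  assumes "a \<le> b" "continuous_on {a..b} z" "z a \<le> 0" "0 < z b"
  obtains s where "a \<le> s" "s < b" "z s = 0" "\<And>t. s < t \<Longrightarrow> t \<le> b \<Longrightarrow> 0 < z t"
proof -
  define S where "S = {t \<in> {a..b}. z t \<le> 0}"
  have "closed S" unfolding S_def
    using continuous_closed_preimage[OF assms(2) closed_real_atLeastAtMost, of "{..0}"]
    by (simp add: vimage_def Int_def)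
  moreover have bdd: "bdd_above S" by (auto simp: S_def intro: bdd_aboveI[of _ b])
  moreover have "S \<noteq> {}" using assms by (auto simp: S_def)
  ultimately have S: "Sup S \<in> S" using closed_contains_Sup by blast
  have above: "t \<le> Sup S" if "t \<in> S" for t using cSup_upper[OF that bdd] .
  have sub: "{Sup S..b} \<subseteq> {a..b}" using S by (auto simp: S_def)
  obtain c where c: "Sup S \<le> c" "c \<le> b" "z c = 0"
    using IVT'[of z "Sup S" 0 b] S assms(4) continuous_on_subset[OF assms(2) sub]
    by (auto simp: S_def)
  then have "c \<in> S" using sub by (auto simp: S_def)
  then have "c = Sup S" using above c(1) by force
  show ?thesis
  proof
    show "a \<le> Sup S" "z (Sup S) = 0" using S c \<open>c = Sup S\<close> by (auto simp: S_def)
    then show "Sup S < b" using S assms(4) by (cases "Sup S = b") (auto simp: S_def)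
    fix t assume "Sup S < t" "t \<le> b"
    then show "0 < z t" using above[of t] S by (force simp: S_def)
  qed
qed

text \<open>Slopes are compared only where \<open>x\<close> exceeds \<open>y\<close>. If
  \<open>x\<close> ended above \<open>y\<close>, then \<open>x - y\<close> would be nonincreasing
  from its last zero on, yet positive at \<open>b\<close>.\<close>

lemma barrier:
  assumes ab: "a \<le> b" and acx: "abs_continuous_on_interval x a b"
    and acy: "abs_continuous_on_interval y a b" and N: "negligible N" and init: "x a \<le> y a"
    and der: "\<And>t. a \<le> t \<Longrightarrow> t \<le> b \<Longrightarrow> t \<notin> N \<Longrightarrow> y t < x t \<Longrightarrow>
      \<exists>x' y'. (x has_real_derivative x') (at t) \<and> (y has_real_derivative y') (at t) \<and> x' \<le> y'"
  shows "x b \<le> y b"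
proof (rule ccontr)
  assume "\<not> x b \<le> y b"
  then have "0 < x b - y b" by simp
  have acz: "abs_continuous_on_interval (\<lambda>t. x t - y t) a b"
    by (rule abs_continuous_diff[OF acx acy])
  obtain s where s: "a \<le> s" "s < b" "x s - y s = 0" "\<And>t. s < t \<Longrightarrow> t \<le> b \<Longrightarrow> 0 < x t - y t"
    by (rule last_zero[OF ab abs_continuous_imp_continuous[OF acz]])
       (use init \<open>0 < x b - y b\<close> in auto)
  have "x b - y b \<le> x s - y s"
  \<comment> \<open>At \<open>s\<close> the two functions agree and \<open>der\<close> says nothing,
    so \<open>s\<close> joins the null set.\<close>
  proof (rule abs_continuous_nonincreasing[of s b "\<lambda>t. x t - y t" "insert s N"])
    fix t assume t: "t \<in> {s..b}" "t \<notin> insert s N"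
    then obtain x' y' where d: "(x has_real_derivative x') (at t)" "(y has_real_derivative y') (at t)" "x' \<le> y'"
      using der[of t] s(1) s(4)[of t] by auto
    show "\<exists>d\<le>0. ((\<lambda>t. x t - y t) has_real_derivative d) (at t)"
      using DERIV_diff[OF d(1,2)] d(3) by (intro exI[of _ "x' - y'"]) auto
  qed (use s N abs_continuous_mono[OF acz] in auto)
  then show False using s(3) \<open>0 < x b - y b\<close> by simp
qed

text \<open>This is the logarithmic condition for the delay with
  \<open>exp (A * h) = 1 + 1 / \<beta>\<close>, where \<open>exp (- (A * h)) / \<beta>\<close> is
  \<open>1 / (\<beta> + 1)\<close>. The quotient is below \<open>1 + 1 / (\<beta> + 1)\<close>, and
  \<open>exp\<close> lies above its tangent at \<open>0\<close>.\<close>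

lemma ln_yorke_quotient_less:
  fixes \<beta> :: real
  assumes "0 < \<beta>"
  shows "ln ((\<beta>\<^sup>2 + \<beta>) / (\<beta>\<^sup>2 + 1)) < 1 / (\<beta> + 1)"
proof -
  have "(\<beta>\<^sup>2 + \<beta>) * (\<beta> + 1) < (\<beta> + 2) * (\<beta>\<^sup>2 + 1)"
    using assms by (simp add: algebra_simps power2_eq_square)
  then have "(\<beta>\<^sup>2 + \<beta>) / (\<beta>\<^sup>2 + 1) < 1 + 1 / (\<beta> + 1)"
    using assms by (simp add: field_simps add_pos_nonneg)
  also have "\<dots> \<le> exp (1 / (\<beta> + 1))" by (rule exp_ge_add_one_self)
  finally have "(\<beta>\<^sup>2 + \<beta>) / (\<beta>\<^sup>2 + 1) < exp (1 / (\<beta> + 1))" .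
  moreover have "0 < (\<beta>\<^sup>2 + \<beta>) / (\<beta>\<^sup>2 + 1)"
    using assms by (intro divide_pos_pos add_nonneg_pos add_pos_nonneg) auto
  ultimately show ?thesis using ln_less_cancel_iff[of _ "exp (1 / (\<beta> + 1))"] by (metis exp_gt_zero ln_exp)
qed

subsection \<open>Contraction of the amplitude\<close>

text \<open>Bounds on \<open>I\<close> for arbitrary \<open>c \<ge> 0\<close> replace the kernels;
  \<open>c = 0\<close> yields the sign of \<open>I\<close> when \<open>x\<close> has one sign on the
  window. This form survives both \<open>x \<mapsto> - x\<close> and a larger
  \<open>h\<close>.\<close>

locale delayed_feedback =
  fixes a0 A B h T :: real and N :: "real set" and x :: "real \<Rightarrow> real"
  assumes a0_pos: "0 < a0" and a0_le_A: "a0 \<le> A" and B_pos: "0 < B" and h_nonneg: "0 \<le> h"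
    and ac: "\<And>p q. T \<le> p \<Longrightarrow> abs_continuous_on_interval x p q"
    and N: "negligible N"
    and eq: "\<And>t. T \<le> t \<Longrightarrow> t \<notin> N \<Longrightarrow> \<exists>x' a I. (x has_real_derivative x') (at t) \<and>
      x' + a * x t + I = 0 \<and> a0 \<le> a \<and> a \<le> A \<and>
      (\<forall>c\<ge>0. (\<forall>s\<in>{t-h..t}. x s \<le> c) \<longrightarrow> I \<le> B * c) \<and>
      (\<forall>c\<ge>0. (\<forall>s\<in>{t-h..t}. - c \<le> x s) \<longrightarrow> - (B * c) \<le> I)"
begin

text \<open>Depends on \<open>a0\<close> and \<open>B\<close> only, so it is unchanged by
  \<open>minus\<close> and \<open>larger_delay\<close>, whereas \<open>c0\<close> and
  \<open>\<kappa>\<close> follow the delay.\<close>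

definition \<beta> where "\<beta> = B / a0"
abbreviation c0 where "c0 \<equiv> exp (- (A * h)) / \<beta>"
abbreviation \<kappa> where "\<kappa> \<equiv> \<beta> * (\<beta> + 1) * exp (- c0) - \<beta>\<^sup>2"

lemma beta_pos: "0 < \<beta>" using a0_pos B_pos by (simp add: \<beta>_def)

lemma B_times: "B * c = a0 * (\<beta> * c)" using a0_pos by (simp add: \<beta>_def)

text \<open>Negating \<open>x'\<close> and \<open>I\<close> exchanges the two memory bounds, so
  every upper estimate also yields a lower one.\<close>

lemma minus: "delayed_feedback a0 A B h T N (\<lambda>t. - x t)"
proof
  fix t assume "T \<le> t" "t \<notin> N"
  then obtain x' a I where e: "(x has_real_derivative x') (at t)"
      "x' + a * x t + I = 0" "a0 \<le> a" "a \<le> A"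
      "\<And>c. c\<ge>0 \<Longrightarrow> (\<forall>s\<in>{t-h..t}. x s \<le> c) \<Longrightarrow> I \<le> B * c"
      "\<And>c. c\<ge>0 \<Longrightarrow> (\<forall>s\<in>{t-h..t}. - c \<le> x s) \<Longrightarrow> - (B * c) \<le> I"
    using eq by blast
  show "\<exists>x' a I. ((\<lambda>t. - x t) has_real_derivative x') (at t) \<and>
      x' + a * - x t + I = 0 \<and> a0 \<le> a \<and> a \<le> A \<and>
      (\<forall>c\<ge>0. (\<forall>s\<in>{t-h..t}. - x s \<le> c) \<longrightarrow> I \<le> B * c) \<and>
      (\<forall>c\<ge>0. (\<forall>s\<in>{t-h..t}. - c \<le> - x s) \<longrightarrow> - (B * c) \<le> I)"
    using DERIV_minus[OF e(1)] e
    by (intro exI[of _ "- x'"] exI[of _ a] exI[of _ "- I"])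
       (auto simp: minus_le_iff[of _ "B * _"] minus_le_iff[of "x _"])
qed (use a0_pos a0_le_A B_pos h_nonneg ac N abs_continuous_uminus in auto)

text \<open>A bound on the longer window holds on the shorter one. This serves to reach
  \<open>ln (1 + 1 / \<beta>) \<le> A * h\<close>.\<close>

lemma larger_delay:
  assumes "h \<le> h'"
  shows "delayed_feedback a0 A B h' T N x"
proof
  fix t assume "T \<le> t" "t \<notin> N"
  then obtain x' a I where e: "(x has_real_derivative x') (at t)"
      "x' + a * x t + I = 0" "a0 \<le> a" "a \<le> A"
      "\<And>c. c\<ge>0 \<Longrightarrow> (\<forall>s\<in>{t-h..t}. x s \<le> c) \<Longrightarrow> I \<le> B * c"
      "\<And>c. c\<ge>0 \<Longrightarrow> (\<forall>s\<in>{t-h..t}. - c \<le> x s) \<Longrightarrow> - (B * c) \<le> I"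
    using eq by blast
  show "\<exists>x' a I. (x has_real_derivative x') (at t) \<and>
      x' + a * x t + I = 0 \<and> a0 \<le> a \<and> a \<le> A \<and>
      (\<forall>c\<ge>0. (\<forall>s\<in>{t-h'..t}. x s \<le> c) \<longrightarrow> I \<le> B * c) \<and>
      (\<forall>c\<ge>0. (\<forall>s\<in>{t-h'..t}. - c \<le> x s) \<longrightarrow> - (B * c) \<le> I)"
    by (rule exI[of _ x'], rule exI[of _ a], rule exI[of _ I]) (use e assms in auto)
qed (use a0_pos a0_le_A B_pos h_nonneg ac N assms in auto)

section \<open>Estimates before and after a zero\<close>

lemma derivative_le:
  assumes "T \<le> t" "t \<notin> N" "0 \<le> c" "\<And>s. t - h \<le> s \<Longrightarrow> s \<le> t \<Longrightarrow> - c \<le> x s"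
  shows "\<exists>x' a. (x has_real_derivative x') (at t) \<and> a0 \<le> a \<and> a \<le> A \<and> x' \<le> - a * x t + B * c"
proof -
  obtain x' a I where e: "(x has_real_derivative x') (at t)"
      "x' + a * x t + I = 0" "a0 \<le> a" "a \<le> A"
      "\<forall>c\<ge>0. (\<forall>s\<in>{t-h..t}. - c \<le> x s) \<longrightarrow> - (B * c) \<le> I"
    using eq[OF assms(1,2)] by blast
  then have "- (B * c) \<le> I" using assms(3,4) by auto
  then have "x' \<le> - a * x t + B * c" using e(2) by linarith
  then show ?thesis using e by blast
qed

lemma derivative_le_pos:
  assumes "T \<le> t" "t \<notin> N" "0 \<le> c" "\<And>s. t - h \<le> s \<Longrightarrow> s \<le> t \<Longrightarrow> - c \<le> x s" "0 \<le> x t"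
  shows "\<exists>x'. (x has_real_derivative x') (at t) \<and> x' \<le> - a0 * x t + B * c"
proof -
  obtain x' a where e: "(x has_real_derivative x') (at t)" "a0 \<le> a" "x' \<le> - a * x t + B * c"
    using derivative_le[OF assms(1-4)] by blast
  have "a0 * x t \<le> a * x t" using e(2) assms(5) by (rule mult_right_mono)
  then have "x' \<le> - a0 * x t + B * c" using e(3) by linarith
  then show ?thesis using e(1) by blast
qed

text \<open>While \<open>x \<le> 0\<close> and the memory is at least \<open>- m\<close>, the slope
  is at most \<open>- A * x + A * (\<beta> * m)\<close>. From a too negative \<open>x s\<close> the
  solution could not climb to zero by time \<open>t1\<close>.\<close>

lemma backward_bound:
  assumes "T \<le> s" "s \<le> t1" "x t1 = 0" "0 \<le> m" and low: "\<And>u. s - h \<le> u \<Longrightarrow> u \<le> t1 \<Longrightarrow> - m \<le> x u"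
  shows "- x s \<le> \<beta> * m * (exp (A * (t1 - s)) - 1)"
proof (cases "0 \<le> x s")
  case True
  have "0 \<le> \<beta> * m * (exp (A * (t1 - s)) - 1)"
    using beta_pos assms a0_pos a0_le_A by (intro mult_nonneg_nonneg) auto
  then show ?thesis using True by linarith
next
  case False
  \<comment> \<open>Reversing time turns the last zero into the first zero \<open>s'\<close> of
    \<open>x\<close> after \<open>s\<close>, so that \<open>x \<le> 0\<close> on
    \<open>{s..s'}\<close>.\<close>
  have cont: "continuous_on {- t1..- s} (\<lambda>t. - x (- t))"
    by (intro continuous_intros continuous_on_compose2[OF abs_continuous_imp_continuous[OF ac[OF assms(1)], of t1]])
       auto
  obtain s1 where s1: "- t1 \<le> s1" "s1 < - s" "- x (- s1) = 0" "\<And>t. s1 < t \<Longrightarrow> t \<le> - s \<Longrightarrow> 0 < - x (- t)"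
    by (rule last_zero[OF _ cont]) (use assms False in auto)
  define s' where "s' = - s1"
  have s': "s < s'" "s' \<le> t1" "x s' = 0" "\<And>t. s \<le> t \<Longrightarrow> t \<le> s' \<Longrightarrow> x t \<le> 0"
  proof -
    show "s < s'" "s' \<le> t1" "x s' = 0" using s1 by (auto simp: s'_def)
    fix t assume "s \<le> t" "t \<le> s'"
    then show "x t \<le> 0" using s1(3) s1(4)[of "- t"] by (cases "t = s'") (auto simp: s'_def)
  qed
  define Y where "Y u = \<beta> * m * (1 - exp (- (A * (u - s)))) + x s * exp (- (A * (u - s)))" for u
  have dY: "(Y has_real_derivative (- A * Y u + A * (\<beta> * m))) (at u)" for u
    unfolding Y_def by (auto intro!: derivative_eq_intros simp: algebra_simps)
  have "x s' \<le> Y s'"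
  proof (rule barrier[of s s' x Y N])
    show "abs_continuous_on_interval Y s s'"
      by (rule C1_abs_continuous[OF dY])
         (auto simp: Y_def intro!: continuous_intros)
    fix t assume t: "s \<le> t" "t \<le> s'" "t \<notin> N" "Y t < x t"
    then obtain x' a where d: "(x has_real_derivative x') (at t)" "a \<le> A" "x' \<le> - a * x t + B * m"
      using derivative_le[of t m] assms low s' by force
    \<comment> \<open>For nonpositive \<open>x t\<close> the worst coefficient is the largest one,
      \<open>A\<close>; on the positive side it is \<open>a0\<close>.\<close>
    have "- a * x t \<le> - A * x t" using d(2) s'(4)[OF t(1,2)] mult_right_mono_neg[of a A "x t"] by simp
    also have "- A * x t \<le> - A * Y t" using t(4) a0_pos a0_le_A by auto
    finally have "- a * x t \<le> - A * Y t" .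
    moreover have "B * m \<le> A * (\<beta> * m)"
    proof -
      have "a0 * (\<beta> * m) \<le> A * (\<beta> * m)" 
        by (rule mult_right_mono[OF a0_le_A mult_nonneg_nonneg[OF less_imp_le[OF beta_pos] assms(4)]])
      then show ?thesis using B_times[of m] by linarith
    qed
    ultimately have "x' \<le> - A * Y t + A * (\<beta> * m)" using d(3) by linarith
    then show "\<exists>x' y'. (x has_real_derivative x') (at t) \<and> (Y has_real_derivative y') (at t) \<and> x' \<le> y'"
      using d(1) dY by blast
  qed (use s' assms ac N in \<open>auto simp: Y_def\<close>)
  \<comment> \<open>Multiplying \<open>0 \<le> Y s'\<close> by \<open>E\<close> clears the decaying
    exponential and isolates \<open>x s\<close>.\<close>
  define E where "E = exp (A * (s' - s))"
  have "0 \<le> Y s' * E" using \<open>x s' \<le> Y s'\<close> s'(3) by (simp add: E_def)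
  also have "\<dots> = \<beta> * m * (E - 1) + x s"
  proof -
    have "exp (- (A * (s' - s))) * E = 1" by (simp add: E_def exp_add[symmetric])
    then have "(k * (1 - exp (- (A * (s' - s)))) + l * exp (- (A * (s' - s)))) * E = k * (E - 1) + l" for k l
      by (metis (no_types, opaque_lifting) distrib_right left_diff_distrib mult.assoc mult.left_neutral mult.right_neutral)
    then show ?thesis unfolding Y_def .
  qed
  finally have "- x s \<le> \<beta> * m * (E - 1)" by linarith
  also have "\<dots> \<le> \<beta> * m * (exp (A * (t1 - s)) - 1)"
    using s'(2) beta_pos assms(4) a0_pos a0_le_A by (intro mult_left_mono) (auto simp: E_def)
  finally show ?thesis .
qed

text \<open>After \<open>t1\<close> one has \<open>x' \<le> - a0 * x + B * C\<close>, where
  \<open>- C\<close> bounds the memory from below: \<open>C = m\<close> at first, then the backward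
  bound until \<open>t1 + h\<close>, then \<open>C = 0\<close>. The backward bound is used down to
  \<open>t1 - h\<close>, and the windows there reach \<open>t1 - 2 * h\<close>.\<close>

lemma forward_bound:
  assumes long: "ln (1 + 1 / \<beta>) \<le> A * h" and t1: "T + h \<le> t1" "t1 \<le> t" "x t1 = 0" and m: "0 \<le> m"
    and low: "\<And>u. t1 - 2 * h \<le> u \<Longrightarrow> u \<le> t \<Longrightarrow> - m \<le> x u"
    and pos: "\<And>u. t1 < u \<Longrightarrow> u \<le> t \<Longrightarrow> 0 < x u"
    and nonneg: "0 \<le> \<kappa>"
  shows "x t \<le> \<kappa> * m"
proof -
  have nn: "0 \<le> x u" if "t1 \<le> u" "u \<le> t" for u
    using pos[of u] t1(3) that by (cases "u = t1") auto
  have T: "T \<le> u" if "t1 \<le> u" for u using that t1(1) h_nonneg by linarith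
  define c where "c = c0"
  \<comment> \<open>\<open>w\<close> is the exponent at which the backward bound
    \<open>\<beta> * m * (exp w - 1)\<close> equals \<open>m\<close>; \<open>v\<close> is the excess
    of \<open>A * h\<close> over it.\<close>
  define w where "w = ln (1 + 1 / \<beta>)"
  have b1: "0 < 1 + 1 / \<beta>" using beta_pos by (intro add_pos_pos) auto
  have ew: "exp w = 1 + 1 / \<beta>" unfolding w_def using b1 by (rule exp_ln)
  define v where "v = A * h - w"
  have v: "0 \<le> v" using long by (simp add: v_def w_def)
  have ev: "\<beta> * exp (- v) = \<beta> * (\<beta> + 1) * c"
  proof -
    have "exp (- v) = exp (- (A * h)) * exp w" by (simp add: v_def exp_add[symmetric])
    then show ?thesis unfolding ew c_def using beta_pos by (simp add: field_simps)
  qed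
  define ts where "ts = t1 + v / a0"
  txt \<open>\<open>Y1\<close> and \<open>Y2\<close> solve \<open>Y' = - a0 Y + B C\<close> with the memory bounds \<open>C = m\<close> before \<open>ts\<close> and
    \<open>C = \<beta> m (exp (A h - a0 (u - t1)) - 1)\<close> after \<open>ts\<close>; the two bounds, hence also \<open>Y1\<close> and \<open>Y2\<close>, agree at \<open>ts\<close>.\<close>
  define Y1 where "Y1 u = \<beta> * m * (1 - exp (- (a0 * (u - t1))))" for u
  define Y2 where "Y2 u = m * (\<beta> * (\<beta> + 1) * (exp (- (a0 * (u - ts))) * (1 + a0 * (u - ts) - c)) - \<beta>\<^sup>2)" for u
  have dY1: "(Y1 has_real_derivative (- a0 * Y1 u + B * m)) (at u)" for u
    unfolding B_times[of m] unfolding Y1_def by (auto intro!: derivative_eq_intros simp: algebra_simps)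
  have dY2: "(Y2 has_real_derivative (m * \<beta> * (\<beta> + 1) * a0 * (exp (- (a0 * (u - ts))) * (c - a0 * (u - ts))))) (at u)" for u
    unfolding Y2_def by (auto intro!: derivative_eq_intros simp: algebra_simps)
  have acY1: "abs_continuous_on_interval Y1 p q" for p q
    by (rule C1_abs_continuous[OF dY1]) (auto simp: Y1_def intro!: continuous_intros)
  have acY2: "abs_continuous_on_interval Y2 p q" for p q
    by (rule C1_abs_continuous[OF dY2]) (auto intro!: continuous_intros)
  have ts: "t1 \<le> ts" "a0 * (ts - t1) = v" using v a0_pos by (auto simp: ts_def)
  \<comment> \<open>The tangent inequality, with equality at \<open>\<sigma> = c\<close>, gives the
    maximum of \<open>Y2\<close> directly; this is the origin of \<open>\<kappa>\<close>.\<close>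
  have Y2le: "Y2 u \<le> \<kappa> * m" for u
  proof -
    define \<sigma> where "\<sigma> = a0 * (u - ts)"
    have "1 + \<sigma> - c \<le> exp (\<sigma> - c)" using exp_ge_add_one_self[of "\<sigma> - c"] by linarith
    then have "exp (- \<sigma>) * (1 + \<sigma> - c) \<le> exp (- \<sigma>) * exp (\<sigma> - c)" by simp
    also have "\<dots> = exp (- c)" by (simp add: exp_add[symmetric])
    finally have "\<beta> * (\<beta> + 1) * (exp (- \<sigma>) * (1 + \<sigma> - c)) \<le> \<beta> * (\<beta> + 1) * exp (- c)"
      using beta_pos by (intro mult_left_mono) auto
    then show ?thesis unfolding Y2_def \<sigma>_def[symmetric] c_def[symmetric] using m
      by (subst mult.commute, intro mult_right_mono) auto
  qed
  \<comment> \<open>Both sides equal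
    \<open>m * (\<beta> - \<beta> * (\<beta> + 1) * c)\<close>.\<close>
  have Y12: "Y1 ts = Y2 ts"
    using ev unfolding Y1_def Y2_def ts(2) by (simp add: algebra_simps power2_eq_square)
  have phase1: "x u \<le> Y1 u" if u: "t1 \<le> u" "u \<le> t" for u
  proof (rule barrier[OF u(1) ac acY1 N])
    fix s assume s: "t1 \<le> s" "s \<le> u" "s \<notin> N" "Y1 s < x s"
    obtain x' where d: "(x has_real_derivative x') (at s)" "x' \<le> - a0 * x s + B * m"
      using derivative_le_pos[of s m] T[of s] s low nn[of s] u m h_nonneg by force
    have "x' \<le> - a0 * Y1 s + B * m" using d(2) s(4) a0_pos by (smt (verit) mult_left_mono mult_minus_left)
    then show "\<exists>x' y'. (x has_real_derivative x') (at s) \<and> (Y1 has_real_derivative y') (at s) \<and> x' \<le> y'"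
      using d(1) dY1 by blast
  qed (use t1 T in \<open>auto simp: Y1_def\<close>)
  have early: "x u \<le> \<kappa> * m" if u: "t1 \<le> u" "u \<le> t" "u \<le> ts" for u
  proof -
    have "Y1 u \<le> Y1 ts" unfolding Y1_def using u a0_pos beta_pos m
      by (intro mult_left_mono) auto
    then show ?thesis using phase1[OF u(1,2)] Y12 Y2le[of ts] by linarith
  qed
  \<comment> \<open>The restriction \<open>u \<le> t1 + h\<close> keeps the exponent in
    \<open>C\<close> nonnegative.\<close>
  have phase2: "x u \<le> Y2 u" if u: "ts \<le> u" "u \<le> t" "u \<le> t1 + h" for u
  proof (rule barrier[OF u(1) ac acY2 N])
    show "x ts \<le> Y2 ts" using phase1[of ts] Y12 ts u by simp
    fix s assume s: "ts \<le> s" "s \<le> u" "s \<notin> N" "Y2 s < x s"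
    define C where "C = \<beta> * m * (exp (A * (t1 - (s - h))) - 1)"
    have "0 \<le> C" unfolding C_def
      using beta_pos m s u a0_pos a0_le_A by (intro mult_nonneg_nonneg) auto
    \<comment> \<open>Before \<open>t1\<close> the backward bound applies and is worst at the left
      end \<open>s - h\<close>; after \<open>t1\<close> the solution is positive.\<close>
    have mem: "- C \<le> x q" if q: "s - h \<le> q" "q \<le> s" for q
    proof (cases "q \<le> t1")
      case True
      have "- x q \<le> \<beta> * m * (exp (A * (t1 - q)) - 1)"
        using True q s u ts t1 m low h_nonneg by (intro backward_bound) auto
      also have "\<dots> \<le> C" unfolding C_def
        using q beta_pos m a0_pos a0_le_A by (intro mult_left_mono) auto
      finally show ?thesis by linarith
    next
      case False
      then show ?thesis using pos[of q] \<open>0 \<le> C\<close> q s u by force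
    qed
    obtain x' where d: "(x has_real_derivative x') (at s)" "x' \<le> - a0 * x s + B * C"
      using derivative_le_pos[of s C] T[of s] s mem \<open>0 \<le> C\<close> nn[of s] u ts by force
    define \<sigma> where "\<sigma> = a0 * (s - ts)"
    \<comment> \<open>Weakening the rate \<open>A\<close> to \<open>a0\<close> gives the memory
      bound the same exponential as the damping, which makes \<open>Y2\<close> explicit.\<close>
    have "A * (t1 - (s - h)) \<le> w - \<sigma>"
    proof -
      have "a0 * (s - t1) \<le> A * (s - t1)" using s ts a0_le_A by (intro mult_right_mono) auto
      moreover have "a0 * (s - t1) = v + \<sigma>" using ts(2) by (simp add: \<sigma>_def algebra_simps)
      ultimately show ?thesis by (simp add: v_def algebra_simps)
    qed
    then have "C \<le> \<beta> * m * (exp (w - \<sigma>) - 1)" unfolding C_def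
      using beta_pos m by (intro mult_left_mono) auto
    also have "exp (w - \<sigma>) = (1 + 1 / \<beta>) * exp (- \<sigma>)" using ew by (simp add: exp_diff exp_minus divide_inverse)
    also have "\<beta> * m * ((1 + 1 / \<beta>) * exp (- \<sigma>) - 1) = m * ((\<beta> + 1) * exp (- \<sigma>) - \<beta>)"
      using beta_pos by (simp add: field_simps)
    finally have "B * C \<le> B * (m * ((\<beta> + 1) * exp (- \<sigma>) - \<beta>))"
      using B_pos by (intro mult_left_mono) auto
    moreover have "a0 * Y2 s \<le> a0 * x s" using s(4) a0_pos by simp
    ultimately have "x' \<le> - a0 * Y2 s + a0 * \<beta> * (m * ((\<beta> + 1) * exp (- \<sigma>) - \<beta>))"
      using d(2) B_times by (simp only: mult_minus_left mult.assoc)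
    also have "\<dots> = m * \<beta> * (\<beta> + 1) * a0 * (exp (- \<sigma>) * (c - \<sigma>))"
      unfolding Y2_def \<sigma>_def[symmetric] by (simp add: algebra_simps power2_eq_square)
    finally have "x' \<le> m * \<beta> * (\<beta> + 1) * a0 * (exp (- \<sigma>) * (c - \<sigma>))" .
    then show "\<exists>x' y'. (x has_real_derivative x') (at s) \<and> (Y2 has_real_derivative y') (at s) \<and> x' \<le> y'"
      using d(1) dY2[of s] unfolding \<sigma>_def by blast
  qed (use t1 T ts in auto)
  have middle: "x u \<le> \<kappa> * m" if "t1 \<le> u" "u \<le> t" "u \<le> t1 + h" for u
    using early[of u] phase2[of u] Y2le[of u] that by linarith
  show ?thesis
  proof (cases "t \<le> t1 + h")
    case True then show ?thesis using middle t1 by simp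
  next
    case False
    \<comment> \<open>Past \<open>t1 + h\<close> the whole window lies where
      \<open>x \<ge> 0\<close>, so \<open>x\<close> can no longer increase.\<close>
    show ?thesis
    proof (rule barrier[of "t1 + h" t x "\<lambda>_. \<kappa> * m" N])
      show "abs_continuous_on_interval (\<lambda>_. \<kappa> * m) (t1 + h) t"
        by (rule C1_abs_continuous[of _ "\<lambda>_. 0"]) auto
      show "x (t1 + h) \<le> \<kappa> * m" using middle False h_nonneg by simp
      fix s assume s: "t1 + h \<le> s" "s \<le> t" "s \<notin> N" "\<kappa> * m < x s"
      obtain x' where d: "(x has_real_derivative x') (at s)" "x' \<le> - a0 * x s + B * 0"
        using derivative_le_pos[of s 0] T[of s] s nn h_nonneg by force
      have "0 \<le> a0 * x s" using nn[of s] s a0_pos h_nonneg by simp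
      then show "\<exists>x' y'. (x has_real_derivative x') (at s) \<and> ((\<lambda>_. \<kappa> * m) has_real_derivative y') (at s) \<and> x' \<le> y'"
        using d by (intro exI[of _ x'] exI[of _ 0]) auto
    qed (use False N ac T h_nonneg in auto)
  qed
qed

section \<open>Eventual bounds, their iteration, and convergence\<close>

lemma eventual_upper_bound:
  assumes long: "ln (1 + 1 / \<beta>) \<le> A * h" and nonneg: "0 \<le> \<kappa>" and m: "0 \<le> m"
    and low: "\<And>u. S \<le> u \<Longrightarrow> - m \<le> x u" and osc: "\<And>s. \<exists>t\<ge>s. x t \<le> 0"
  shows "\<exists>S'. \<forall>t\<ge>S'. x t \<le> \<kappa> * m"
proof -
  \<comment> \<open>The margin \<open>2 * h\<close> places every zero after \<open>p\<close> late
    enough for both nested windows to lie after \<open>S\<close>.\<close>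
  obtain p where p: "max S T + 2 * h \<le> p" "x p \<le> 0" using osc by blast
  have "x t \<le> \<kappa> * m" if t: "p \<le> t" for t
  proof (cases "0 < x t")
    case True
    have "T \<le> p" using p(1) h_nonneg by linarith
    obtain s where s: "p \<le> s" "s < t" "x s = 0" "\<And>u. s < u \<Longrightarrow> u \<le> t \<Longrightarrow> 0 < x u"
      by (rule last_zero[OF t abs_continuous_imp_continuous[OF ac[OF \<open>T \<le> p\<close>]] p(2) True]) blast
    show ?thesis
      by (rule forward_bound[OF long, of s]) (use s p h_nonneg m low nonneg in auto)
  next
    case False
    then show ?thesis using nonneg m mult_nonneg_nonneg[OF nonneg m] by linarith
  qed
  then show ?thesis by blast
qed

lemma eventual_contraction:
  assumes long: "ln (1 + 1 / \<beta>) \<le> A * h" and nonneg: "0 \<le> \<kappa>" and m: "0 \<le> m"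
    and bnd: "\<And>u. S \<le> u \<Longrightarrow> \<bar>x u\<bar> \<le> m"
    and osc: "\<And>s. \<exists>t\<ge>s. x t \<le> 0" "\<And>s. \<exists>t\<ge>s. 0 \<le> x t"
  shows "\<exists>S'. \<forall>t\<ge>S'. \<bar>x t\<bar> \<le> \<kappa> * m"
proof -
  obtain S1 where S1: "\<forall>t\<ge>S1. x t \<le> \<kappa> * m"
    using eventual_upper_bound[OF long nonneg m, of S] bnd osc(1) by force
  obtain S2 where S2: "\<forall>t\<ge>S2. - x t \<le> \<kappa> * m"
    using delayed_feedback.eventual_upper_bound[OF minus long nonneg m, of S] bnd osc(2) by force
  have "\<bar>x t\<bar> \<le> \<kappa> * m" if "max S1 S2 \<le> t" for t using S1 S2 that by (simp add: abs_le_iff)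
  then show ?thesis by blast
qed

text \<open>Once the whole window is positive, the memory bound with \<open>c = 0\<close> gives
  \<open>x' \<le> - a0 * x\<close>, and \<open>x\<close> stays below a decaying exponential.\<close>

lemma tendsto_zero_if_pos:
  assumes "\<And>t. S \<le> t \<Longrightarrow> 0 < x t"
  shows "(x \<longlongrightarrow> 0) at_top"
proof -
  define p where "p = max S T + h"
  have p: "S + h \<le> p" "T \<le> p" using h_nonneg by (auto simp: p_def)
  define Y where "Y t = x p * exp (- (a0 * (t - p)))" for t
  have dY: "(Y has_real_derivative (- a0 * Y t)) (at t)" for t
    unfolding Y_def by (auto intro!: derivative_eq_intros)
  have le: "x t \<le> Y t" if t: "p \<le> t" for t
  proof (rule barrier[OF t ac _ N])
    show "abs_continuous_on_interval Y p t"
      by (rule C1_abs_continuous[OF dY]) (auto simp: Y_def intro!: continuous_intros)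
    fix s assume s: "p \<le> s" "s \<le> t" "s \<notin> N" "Y s < x s"
    have nn: "0 \<le> x u" if "s - h \<le> u" for u using assms[of u] that s(1) p(1) by simp
    obtain x' where d: "(x has_real_derivative x') (at s)" "x' \<le> - a0 * x s + B * 0"
      using derivative_le_pos[of s 0] p s nn h_nonneg by force
    have "a0 * Y s \<le> a0 * x s" using s(4) a0_pos by simp
    then have "x' \<le> - a0 * Y s" using d(2) by simp
    then show "\<exists>x' y'. (x has_real_derivative x') (at s) \<and> (Y has_real_derivative y') (at s) \<and> x' \<le> y'"
      using d(1) dY by blast
  qed (use p in \<open>auto simp: Y_def\<close>)
  have "filterlim (\<lambda>t. - (a0 * (t - p))) at_bot at_top"
    unfolding filterlim_uminus_at_top[symmetric]
    using filterlim_tendsto_pos_mult_at_top[OF tendsto_const a0_pos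
        filterlim_tendsto_add_at_top[OF tendsto_const[of "- p"] filterlim_ident]] by simp
  then have "((\<lambda>t. exp (- (a0 * (t - p)))) \<longlongrightarrow> 0) at_top"
    by (rule filterlim_compose[OF exp_at_bot])
  then have lim: "(Y \<longlongrightarrow> 0) at_top" unfolding Y_def by (rule tendsto_mult_right_zero)
  show ?thesis
  proof (rule tendsto_sandwich[OF _ _ tendsto_const lim])
    show "\<forall>\<^sub>F t in at_top. 0 \<le> x t"
      using eventually_ge_at_top[of S] by eventually_elim (use assms in force)
    show "\<forall>\<^sub>F t in at_top. x t \<le> Y t"
      using eventually_ge_at_top[of p] by eventually_elim (rule le)
  qed
qed

text \<open>If both weak signs recur, iterated contraction bounds the amplitude by
  \<open>\<kappa> ^ n * m\<close>. Otherwise \<open>x\<close> has a strict sign from some time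
  on.\<close>

lemma tendsto_zero_long_delay:
  assumes long: "ln (1 + 1 / \<beta>) \<le> A * h" and \<kappa>: "0 \<le> \<kappa>" "\<kappa> < 1"
    and bnd: "\<And>u. S \<le> u \<Longrightarrow> \<bar>x u\<bar> \<le> m"
  shows "(x \<longlongrightarrow> 0) at_top"
proof (cases "(\<forall>s. \<exists>t\<ge>s. x t \<le> 0) \<and> (\<forall>s. \<exists>t\<ge>s. 0 \<le> x t)")
  case True
  have "0 \<le> m" using bnd[of S] by linarith
  have iter: "\<exists>S'. \<forall>t\<ge>S'. \<bar>x t\<bar> \<le> \<kappa> ^ n * m" for n
  proof (induction n)
    case 0 then show ?case using bnd by auto
  next
    case (Suc n)
    then obtain S' where "\<forall>t\<ge>S'. \<bar>x t\<bar> \<le> \<kappa> ^ n * m" by blast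
    then have "\<exists>S'. \<forall>t\<ge>S'. \<bar>x t\<bar> \<le> \<kappa> * (\<kappa> ^ n * m)"
      using True \<kappa>(1) \<open>0 \<le> m\<close> by (intro eventual_contraction[OF long \<kappa>(1), of _ S']) auto
    then show ?case by (simp add: mult.assoc)
  qed
  show ?thesis
  proof (rule tendstoI)
    fix e :: real assume "e > 0"
    have "(\<lambda>n. \<kappa> ^ n * m) \<longlonglongrightarrow> 0"
      using \<kappa> by (intro tendsto_mult_left_zero LIMSEQ_power_zero) auto
    then obtain n where n: "\<kappa> ^ n * m < e"
      using \<open>e > 0\<close> by (metis (no_types, lifting) eventually_sequentially order.refl order_tendstoD(2))
    obtain S' where "\<forall>t\<ge>S'. \<bar>x t\<bar> \<le> \<kappa> ^ n * m" using iter by blast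
    then show "\<forall>\<^sub>F t in at_top. dist (x t) 0 < e"
      using n unfolding eventually_at_top_linorder by (intro exI[of _ S']) (force simp: dist_real_def)
  qed
next
  case False
  then consider s where "\<And>t. s \<le> t \<Longrightarrow> 0 < x t" | s where "\<And>t. s \<le> t \<Longrightarrow> 0 < - x t"
    by (metis linorder_not_less neg_0_less_iff_less)
  then show ?thesis
  proof cases
    case 1 then show ?thesis by (rule tendsto_zero_if_pos)
  next
    case 2
    have "((\<lambda>t. - x t) \<longlongrightarrow> 0) at_top" by (rule delayed_feedback.tendsto_zero_if_pos[OF minus 2])
    then show ?thesis using tendsto_minus_cancel_left by force
  qed
qed

lemma tendsto_zero:
  assumes yorke: "ln ((\<beta>\<^sup>2 + \<beta>) / (\<beta>\<^sup>2 + 1)) < c0"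
    and bnd: "\<And>u. S \<le> u \<Longrightarrow> \<bar>x u\<bar> \<le> m"
  shows "(x \<longlongrightarrow> 0) at_top"
proof -
  define w where "w = ln (1 + 1 / \<beta>)"
  have b1: "0 < 1 + 1 / \<beta>" using beta_pos by (intro add_pos_pos) auto
  have "\<beta> * (1 + 1 / \<beta>) = \<beta> + 1" using beta_pos by (simp add: distrib_left)
  then have ew: "exp (- w) / \<beta> = 1 / (\<beta> + 1)"
    unfolding w_def exp_minus exp_ln[OF b1] by (metis divide_divide_eq_left' inverse_eq_divide)
  have A: "0 < A" using a0_pos a0_le_A by linarith
  define h' where "h' = max h (w / A)"
  have h': "h \<le> h'" "w \<le> A * h'" using A by (auto simp: h'_def max_def field_simps)
  define c where "c = exp (- (A * h')) / \<beta>"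
  have lnc: "ln ((\<beta>\<^sup>2 + \<beta>) / (\<beta>\<^sup>2 + 1)) < c"
  proof (cases "w / A \<le> h")
    case True then show ?thesis using yorke by (simp add: c_def h'_def max_def)
  next
    case False
    then have "A * h' = w" using A by (simp add: h'_def max_def)
    then show ?thesis using ew ln_yorke_quotient_less[OF beta_pos] by (simp add: c_def)
  qed
  have q: "0 < (\<beta>\<^sup>2 + \<beta>) / (\<beta>\<^sup>2 + 1)"
    using beta_pos by (intro divide_pos_pos add_nonneg_pos add_pos_nonneg) auto
  have "(\<beta>\<^sup>2 + \<beta>) / (\<beta>\<^sup>2 + 1) < exp c"
    using lnc q by (metis exp_less_mono exp_ln)
  then have "\<beta>\<^sup>2 + \<beta> < exp c * (\<beta>\<^sup>2 + 1)"
    by (simp only: pos_divide_less_eq[OF add_nonneg_pos[OF zero_le_power2 zero_less_one]])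
  \<comment> \<open>After multiplication by \<open>exp (- c)\<close> the logarithmic condition reads
    \<open>\<kappa> < 1\<close> for the delay \<open>h'\<close>.\<close>
  then have "(\<beta>\<^sup>2 + \<beta>) * exp (- c) < exp c * (\<beta>\<^sup>2 + 1) * exp (- c)" by (rule mult_strict_right_mono) simp
  also have "\<dots> = \<beta>\<^sup>2 + 1" by (simp add: exp_minus)
  finally have k1: "\<beta> * (\<beta> + 1) * exp (- c) - \<beta>\<^sup>2 < 1" by (simp add: algebra_simps power2_eq_square)
  \<comment> \<open>The enlarged delay bounds \<open>c\<close>; with
    \<open>exp (- c) \<ge> 1 - c\<close> this is just enough for
    \<open>\<kappa> \<ge> 0\<close>.\<close>
  have "c \<le> 1 / (\<beta> + 1)"
    unfolding ew[symmetric] c_def using h'(2) beta_pos by (intro divide_right_mono) auto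
  then have "1 - 1 / (\<beta> + 1) \<le> exp (- c)" using exp_ge_add_one_self[of "- c"] by linarith
  then have "\<beta> * (\<beta> + 1) * (1 - 1 / (\<beta> + 1)) \<le> \<beta> * (\<beta> + 1) * exp (- c)"
    using beta_pos by (intro mult_left_mono) auto
  moreover have "b * (b + 1) * (1 - 1 / (b + 1)) = b\<^sup>2" if "0 < b" for b :: real
    using that by (simp add: field_simps power2_eq_square)
  ultimately have k0: "0 \<le> \<beta> * (\<beta> + 1) * exp (- c) - \<beta>\<^sup>2" using beta_pos by (metis diff_ge_0_iff_ge)
  show ?thesis
    using delayed_feedback.tendsto_zero_long_delay[OF larger_delay[OF h'(1)], of S m] h'(2) k0 k1 bnd
    unfolding w_def c_def by blast
qed

end

subsection \<open>Stieltjes integrals and the theorem\<close>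

lemma AE_lebesgue_on_negligible:
  fixes S :: "real set"
  assumes "AE t in lebesgue_on S. P t" "S \<in> sets lebesgue"
  shows "negligible {t \<in> S. \<not> P t}"
proof -
  have "AE t in lebesgue. t \<in> S \<longrightarrow> P t"
    using assms by (subst (asm) AE_restrict_space_iff) auto
  then obtain N where N: "{t \<in> space lebesgue. \<not> (t \<in> S \<longrightarrow> P t)} \<subseteq> N"
      "emeasure lebesgue N = 0" "N \<in> sets lebesgue"
    by (rule AE_E)
  have "negligible N" using N(2,3) unfolding negligible_iff_null_sets by (rule null_setsI)
  then show ?thesis by (rule negligible_subset) (use N(1) in auto)
qed

text \<open>The weights are nonnegative and sum to nearly \<open>1\<close>, so a Riemann sum is
  nearly a weighted mean of values at most \<open>M\<close>. One division fine for both mesh sizes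
  serves both integrals.\<close>

lemma has_stieltjes_integral_le:
  assumes mono: "mono_on {a..b} r" and one: "has_stieltjes_integral (\<lambda>s. 1) r a b 1"
    and u: "has_stieltjes_integral u r a b I" and le: "\<And>s. a \<le> s \<Longrightarrow> s \<le> b \<Longrightarrow> u s \<le> M"
  shows "I \<le> M"
proof (rule field_le_epsilon)
  fix e :: real assume "e > 0"
  define \<epsilon> where "\<epsilon> = e / (\<bar>M\<bar> + 1)"
  \<comment> \<open>\<open>\<bar>M\<bar> * \<epsilon>\<close> covers the deviation of the total
    weight from \<open>1\<close>, and one more \<open>\<epsilon>\<close> that of the sum from
    \<open>I\<close>.\<close>
  have \<epsilon>: "\<epsilon> > 0" "(\<bar>M\<bar> + 1) * \<epsilon> = e" using \<open>e > 0\<close> by (auto simp: \<epsilon>_def add_pos_nonneg field_simps)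
  obtain \<delta>1 where \<delta>1: "\<delta>1 > 0" "\<And>p. p tagged_division_of {a..b} \<Longrightarrow> (\<lambda>s. ball s \<delta>1) fine p \<Longrightarrow>
      \<bar>(\<Sum>(s, K)\<in>p. 1 * (r (Sup K) - r (Inf K))) - 1\<bar> < \<epsilon>"
    using one[unfolded has_stieltjes_integral_def, rule_format, OF \<epsilon>(1)] by blast
  obtain \<delta>2 where \<delta>2: "\<delta>2 > 0" "\<And>p. p tagged_division_of {a..b} \<Longrightarrow> (\<lambda>s. ball s \<delta>2) fine p \<Longrightarrow>
      \<bar>(\<Sum>(s, K)\<in>p. u s * (r (Sup K) - r (Inf K))) - I\<bar> < \<epsilon>"
    using u[unfolded has_stieltjes_integral_def, rule_format, OF \<epsilon>(1)] by blast
  have "gauge (\<lambda>s. ball s (min \<delta>1 \<delta>2))" using \<delta>1(1) \<delta>2(1) by (simp add: gauge_def)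
  then obtain p where p: "p tagged_division_of {a..b}" "(\<lambda>s. ball s (min \<delta>1 \<delta>2)) fine p"
    using fine_division_exists_real by blast
  define V where "V = (\<Sum>(s, K)\<in>p. r (Sup K) - r (Inf K))"
  have "(\<lambda>s. ball s \<delta>1) fine p" "(\<lambda>s. ball s \<delta>2) fine p"
    by (meson fineI fineD[OF p(2)] min.cobounded1 min.cobounded2 order_trans subset_ball)+
  then have s1: "\<bar>V - 1\<bar> < \<epsilon>"
    and s2: "\<bar>(\<Sum>(s, K)\<in>p. u s * (r (Sup K) - r (Inf K))) - I\<bar> < \<epsilon>"
    using \<delta>1(2)[OF p(1)] \<delta>2(2)[OF p(1)] by (simp_all add: V_def)
  have "(\<Sum>(s, K)\<in>p. u s * (r (Sup K) - r (Inf K))) \<le> (\<Sum>(s, K)\<in>p. M * (r (Sup K) - r (Inf K)))"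
  proof (rule sum_mono)
    fix i assume "i \<in> p"
    moreover obtain s K where i: "i = (s, K)" by force
    ultimately have sK: "s \<in> K" "K \<subseteq> {a..b}" "\<exists>c d. K = cbox c d"
      using tagged_division_ofD[OF p(1)] by blast+
    then obtain c d where K: "K = {c..d}" by auto
    then have "c \<le> d" "a \<le> c" "d \<le> b" "a \<le> s" "s \<le> b" using sK by auto
    then have "r c \<le> r d" "u s \<le> M" using mono_onD[OF mono, of c d] le by auto
    then show "(case i of (s, K) \<Rightarrow> u s * (r (Sup K) - r (Inf K))) \<le>
        (case i of (s, K) \<Rightarrow> M * (r (Sup K) - r (Inf K)))"
      using i K \<open>c \<le> d\<close> by (auto intro: mult_right_mono)
  qed
  also have "\<dots> = M * V" by (simp add: V_def sum_distrib_left split_beta)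
  also have "\<dots> \<le> M + \<bar>M\<bar> * \<epsilon>"
  proof -
    have "M * (V - 1) \<le> \<bar>M\<bar> * \<bar>V - 1\<bar>" by (metis abs_ge_self abs_mult)
    also have "\<dots> \<le> \<bar>M\<bar> * \<epsilon>" using s1 by (intro mult_left_mono) auto
    finally show ?thesis by (simp add: algebra_simps)
  qed
  finally have "I \<le> M + \<bar>M\<bar> * \<epsilon> + \<epsilon>" using s2 by linarith
  then show "I \<le> M + e" using \<epsilon>(2) by (simp add: algebra_simps)
qed

lemma has_stieltjes_integral_minus:
  assumes "has_stieltjes_integral u r a b I"
  shows "has_stieltjes_integral (\<lambda>s. - u s) r a b (- I)"
proof -
  have "\<bar>(\<Sum>(s, K)\<in>p. - u s * (r (Sup K) - r (Inf K))) - - I\<bar>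
      = \<bar>(\<Sum>(s, K)\<in>p. u s * (r (Sup K) - r (Inf K))) - I\<bar>" for p
    by (simp add: split_beta sum_negf)
  then show ?thesis using assms unfolding has_stieltjes_integral_def by simp
qed

section \<open>Reduction of the equation to the abstract feedback inequality\<close>

theorem theorem6:
  fixes m :: nat
    and f :: "real \<Rightarrow> real \<Rightarrow> real"
    and g R :: "nat \<Rightarrow> real \<Rightarrow> real \<Rightarrow> real"
    and h :: "nat \<Rightarrow> real \<Rightarrow> real"
    and x10 x20 :: ereal
    and x1 x2 a0 A h0 b0 :: real
    and b :: "nat \<Rightarrow> real"
  assumes h_measurable: "\<And>k. k \<in> {1..m} \<Longrightarrow> h k \<in> borel_measurable (lebesgue_on {0..})"
    and h_le: "\<And>k t. k \<in> {1..m} \<Longrightarrow> t \<ge> 0 \<Longrightarrow> h k t \<le> t"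
    and h_lim: "\<And>k. k \<in> {1..m} \<Longrightarrow> filterlim (h k) at_top at_top"
    and R_mono: "\<And>k. k \<in> {1..m} \<Longrightarrow> AE t in lebesgue_on {0..}. mono_on {h k t..t} (R k t)"
    and R_one: "\<And>k. k \<in> {1..m} \<Longrightarrow>
      AE t in lebesgue_on {0..}. has_stieltjes_integral (\<lambda>s. 1) (R k t) (h k t) t 1"
    and f_cont: "continuous_on ({0..} \<times> UNIV) (\<lambda>(t, u). f t u)"
    and g_cont: "\<And>k. k \<in> {1..m} \<Longrightarrow> continuous_on ({0..} \<times> UNIV) (\<lambda>(t, u). g k t u)"
    and f_zero: "\<And>t. t \<ge> 0 \<Longrightarrow> f t 0 = 0"
    and g_zero: "\<And>k t. k \<in> {1..m} \<Longrightarrow> t \<ge> 0 \<Longrightarrow> g k t 0 = 0"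
    and f_sign: "\<And>t u. t \<ge> 0 \<Longrightarrow> u \<noteq> 0 \<Longrightarrow> f t u * u > 0"
    and g_sign: "\<And>k t u. k \<in> {1..m} \<Longrightarrow> t \<ge> 0 \<Longrightarrow> u \<noteq> 0 \<Longrightarrow> g k t u * u > 0"
    and x0_bounds: "x10 \<le> 0" "0 \<le> x20"
    and x_bounds: "x1 \<le> 0" "0 \<le> x2"
    and global: "\<And>\<phi>. initial_function x10 x20 \<phi> \<Longrightarrow>
      (\<exists>!x. solution m f g h R \<phi> x) \<and>
      (\<forall>x. solution m f g h R \<phi> x \<longrightarrow> (\<forall>t\<ge>0. x1 \<le> x t \<and> x t \<le> x2))"
    and pos: "a0 > 0" "A > 0" "\<And>k. k \<in> {1..m} \<Longrightarrow> b k > 0"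
    and f_bounds: "\<And>t u. t \<ge> 0 \<Longrightarrow> x1 \<le> u \<Longrightarrow> u \<le> x2 \<Longrightarrow> u \<noteq> 0 \<Longrightarrow>
      a0 \<le> f t u / u \<and> f t u / u \<le> A"
    and g_bounds: "\<And>k t u. k \<in> {1..m} \<Longrightarrow> t \<ge> 0 \<Longrightarrow> x1 \<le> u \<Longrightarrow> u \<le> x2 \<Longrightarrow> u \<noteq> 0 \<Longrightarrow>
      0 \<le> g k t u / u \<and> g k t u / u \<le> b k"
    and delay: "\<And>k t. k \<in> {1..m} \<Longrightarrow> t \<ge> 0 \<Longrightarrow> t - h k t \<le> h0"
    and b0_def: "b0 = (\<Sum>k=1..m. b k)"
    and yorke: "a0 / b0 * exp (- A * h0) > ln ((b0\<^sup>2 + a0 * b0) / (b0\<^sup>2 + a0\<^sup>2))"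
  shows "\<forall>\<phi> x. initial_function x10 x20 \<phi> \<longrightarrow> solution m f g h R \<phi> x \<longrightarrow> (x \<longlongrightarrow> 0) at_top"
proof (intro allI impI)
  fix \<phi> x assume init: "initial_function x10 x20 \<phi>" and sol: "solution m f g h R \<phi> x"
  have rng: "x1 \<le> x t" "x t \<le> x2" if "0 \<le> t" for t using global[OF init] sol that by auto
  show "(x \<longlongrightarrow> 0) at_top"
  proof (cases "x1 = 0 \<and> x2 = 0")
    case True
    have "x t = 0" if "0 \<le> t" for t using rng[OF that] True by simp
    then have "\<forall>\<^sub>F t in at_top. x t = 0" by (rule eventually_mono[OF eventually_ge_at_top])
    then show ?thesis by (rule tendsto_eventually)
  next
    case False
    \<comment> \<open>A nonzero admissible value is what allows \<open>a0 \<le> A\<close> to be read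
      off the bounds on \<open>f\<close>.\<close>
    then obtain u0 where "x1 \<le> u0" "u0 \<le> x2" "u0 \<noteq> 0"
      using x_bounds that[of x1] that[of x2] by linarith
    then have "a0 \<le> A" using f_bounds[of 0 u0] by linarith
    \<comment> \<open>For \<open>m = 0\<close> the conventions \<open>a0 / 0 = 0\<close> and
      \<open>ln 0 = 0\<close> turn the hypothesis into \<open>0 > 0\<close>.\<close>
    have "m \<noteq> 0" using yorke b0_def by (cases "m = 0") auto
    then have m1: "1 \<in> {1..m}" by simp
    have b0: "0 < b0" unfolding b0_def using pos(3) m1 by (intro sum_pos) auto
    have h0: "0 \<le> h0" using h_le[OF m1, of 0] delay[OF m1, of 0] by simp
    define N where "N = {t \<in> {0..}. \<not> (\<exists>x' I.
        (x has_real_derivative x') (at t) \<and>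
        (\<forall>k\<in>{1..m}. has_stieltjes_integral (\<lambda>s. g k t (x s)) (R k t) (h k t) t (I k)) \<and>
        x' + f t (x t) + (\<Sum>k=1..m. I k) = 0)}
      \<union> (\<Union>k\<in>{1..m}. {t \<in> {0..}. \<not> mono_on {h k t..t} (R k t)})
      \<union> (\<Union>k\<in>{1..m}. {t \<in> {0..}. \<not> has_stieltjes_integral (\<lambda>s. 1) (R k t) (h k t) t 1})"
    have N: "negligible N"
    proof -
      have half: "{0::real..} \<in> sets lebesgue" by simp
      have U: "negligible (\<Union>k\<in>{1..m}. {t \<in> {0..}. \<not> Q k t})"
        if "\<And>k. k \<in> {1..m} \<Longrightarrow> AE t in lebesgue_on {0..}. Q k t" for Q :: "nat \<Rightarrow> real \<Rightarrow> bool"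
        using AE_lebesgue_on_negligible[OF that half] by (intro negligible_Union finite_imageI) blast+
      note ae = sol[unfolded solution_def, THEN conjunct2, THEN conjunct1]
      show ?thesis
        unfolding N_def
        by (intro negligible_Un AE_lebesgue_on_negligible[OF ae half] U R_mono R_one)
    qed
    \<comment> \<open>The quotient bound handles \<open>v > 0\<close>; for \<open>v \<le> 0\<close>
      the sign condition gives \<open>g k t v \<le> 0\<close>.\<close>
    have g_le: "g k t v \<le> b k * c" if "k \<in> {1..m}" "0 \<le> t" "x1 \<le> v" "v \<le> x2" "v \<le> c" "0 \<le> c" for k t v c
    proof (cases "0 < v")
      case True
      then have "g k t v \<le> b k * v" using g_bounds[OF that(1-4)] by (simp add: field_simps)
      also have "\<dots> \<le> b k * c" using that pos(3)[OF that(1)] by (intro mult_left_mono) auto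
      finally show ?thesis .
    next
      case False
      then have "g k t v \<le> 0" using g_sign[OF that(1,2), of v] g_zero[OF that(1,2)]
        by (cases "v = 0") (auto simp: zero_less_mult_iff)
      also have "0 \<le> b k * c" using that pos(3)[OF that(1)] by simp
      finally show ?thesis .
    qed
    have g_ge: "- (b k * c) \<le> g k t v" if "k \<in> {1..m}" "0 \<le> t" "x1 \<le> v" "v \<le> x2" "- c \<le> v" "0 \<le> c" for k t v c
    proof (cases "v < 0")
      case True
      then have "b k * v \<le> g k t v" using g_bounds[OF that(1-4)] by (simp add: field_simps)
      moreover have "b k * (- c) \<le> b k * v" using that pos(3)[OF that(1)] by (intro mult_left_mono) auto
      ultimately show ?thesis by simp
    next
      case False
      then have "0 \<le> g k t v" using g_sign[OF that(1,2), of v] g_zero[OF that(1,2)]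
        by (cases "v = 0") (auto simp: zero_less_mult_iff)
      moreover have "0 \<le> b k * c" using that pos(3)[OF that(1)] by simp
      ultimately show ?thesis by linarith
    qed
    \<comment> \<open>Starting at time \<open>h0\<close> keeps every window
      \<open>{t - h0..t}\<close> in \<open>{0..}\<close>, where \<open>x\<close> lies between
      \<open>x1\<close> and \<open>x2\<close>; this range is not assumed for the initial
      function.\<close>
    interpret delayed_feedback a0 A b0 h0 h0 N x
    proof
      show "abs_continuous_on_interval x p q" if "h0 \<le> p" for p q
      proof -
        have "abs_continuous_on_interval x 0 (max 0 q)" using sol by (simp add: solution_def)
        then show ?thesis by (rule abs_continuous_mono) (use that h0 in auto)
      qed
      fix t assume t: "h0 \<le> t" "t \<notin> N"
      then have "0 \<le> t" using h0 by linarith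
      obtain x' I where e: "(x has_real_derivative x') (at t)"
          "\<And>k. k \<in> {1..m} \<Longrightarrow> has_stieltjes_integral (\<lambda>s. g k t (x s)) (R k t) (h k t) t (I k)"
          "x' + f t (x t) + (\<Sum>k=1..m. I k) = 0"
        using t(2) \<open>0 \<le> t\<close> unfolding N_def by blast
      have R: "mono_on {h k t..t} (R k t)" "has_stieltjes_integral (\<lambda>s. 1) (R k t) (h k t) t 1"
        if "k \<in> {1..m}" for k using t(2) \<open>0 \<le> t\<close> that unfolding N_def by blast+
      have mem: "t - h0 \<le> h k t" if "k \<in> {1..m}" for k
        using delay[OF that \<open>0 \<le> t\<close>] by linarith
      have upper: "(\<Sum>k=1..m. I k) \<le> b0 * c" if c: "0 \<le> c" "\<forall>s\<in>{t-h0..t}. x s \<le> c" for c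
      proof -
        have "I k \<le> b k * c" if k: "k \<in> {1..m}" for k
        proof (rule has_stieltjes_integral_le[OF R[OF k] e(2)[OF k]])
          fix s assume s: "h k t \<le> s" "s \<le> t"
          then have "t - h0 \<le> s" using mem[OF k] by linarith
          then show "g k t (x s) \<le> b k * c"
            using rng[of s] t(1) s c by (intro g_le[OF k \<open>0 \<le> t\<close>]) auto
        qed
        then show ?thesis unfolding b0_def sum_distrib_right by (rule sum_mono)
      qed
      have lower: "- (b0 * c) \<le> (\<Sum>k=1..m. I k)" if c: "0 \<le> c" "\<forall>s\<in>{t-h0..t}. - c \<le> x s" for c
      proof -
        have "- I k \<le> b k * c" if k: "k \<in> {1..m}" for k
        proof (rule has_stieltjes_integral_le[OF R[OF k] has_stieltjes_integral_minus[OF e(2)[OF k]]])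
          fix s assume s: "h k t \<le> s" "s \<le> t"
          then have "t - h0 \<le> s" using mem[OF k] by linarith
          then have "- (b k * c) \<le> g k t (x s)"
            using rng[of s] t(1) s c by (intro g_ge[OF k \<open>0 \<le> t\<close>]) auto
          then show "- g k t (x s) \<le> b k * c" by linarith
        qed
        then have "(\<Sum>k=1..m. - I k) \<le> b0 * c" unfolding b0_def sum_distrib_right by (rule sum_mono)
        then show ?thesis by (simp add: sum_negf)
      qed
      \<comment> \<open>At a zero of \<open>x\<close> any coefficient between \<open>a0\<close> and
        \<open>A\<close> fits, because \<open>f t 0 = 0\<close>.\<close>
      define a where "a = (if x t = 0 then a0 else f t (x t) / x t)"
      have "a * x t = f t (x t)" using f_zero[OF \<open>0 \<le> t\<close>] by (simp add: a_def)
      moreover have "a0 \<le> a" "a \<le> A"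
        using f_bounds[OF \<open>0 \<le> t\<close> rng[OF \<open>0 \<le> t\<close>]] \<open>a0 \<le> A\<close> by (auto simp: a_def)
      ultimately show "\<exists>x' a I. (x has_real_derivative x') (at t) \<and>
          x' + a * x t + I = 0 \<and> a0 \<le> a \<and> a \<le> A \<and>
          (\<forall>c\<ge>0. (\<forall>s\<in>{t-h0..t}. x s \<le> c) \<longrightarrow> I \<le> b0 * c) \<and>
          (\<forall>c\<ge>0. (\<forall>s\<in>{t-h0..t}. - c \<le> x s) \<longrightarrow> - (b0 * c) \<le> I)"
        using e(1,3) upper lower
        by (intro exI[of _ x'] exI[of _ a] exI[of _ "\<Sum>k=1..m. I k"]) auto
    qed (use pos \<open>a0 \<le> A\<close> b0 h0 N in auto)
    \<comment> \<open>Numerator and denominator are divided by \<open>a0\<^sup>2\<close>.\<close>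
    have "(b0\<^sup>2 + a0 * b0) / (b0\<^sup>2 + a0\<^sup>2) = (\<beta>\<^sup>2 + \<beta>) / (\<beta>\<^sup>2 + 1)"
    proof -
      have "\<beta>\<^sup>2 + \<beta> = (b0\<^sup>2 + a0 * b0) / a0\<^sup>2" "\<beta>\<^sup>2 + 1 = (b0\<^sup>2 + a0\<^sup>2) / a0\<^sup>2"
        using a0_pos by (auto simp: \<beta>_def field_simps power2_eq_square)
      then show ?thesis using a0_pos by simp
    qed
    moreover have "a0 / b0 * exp (- A * h0) = exp (- (A * h0)) / \<beta>"
      by (simp add: \<beta>_def)
    ultimately have y: "ln ((\<beta>\<^sup>2 + \<beta>) / (\<beta>\<^sup>2 + 1)) < exp (- (A * h0)) / \<beta>" using yorke by simp
    show ?thesis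
    proof (rule tendsto_zero[OF y])
      fix t :: real assume "0 \<le> t"
      then show "\<bar>x t\<bar> \<le> max (- x1) x2" using rng[of t] by (auto simp: abs_le_iff)
    qed
  qed
qed

end
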